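(* Let $a_1,a_2,a_3$ be distinct non-null points such that the lines $a_1a_2$, $a_2a_3$ and $a_1a_3$ are non-null. Let $q_1\equiv q(a_2,a_3)$, $q_2\equiv q(a_1,a_3)$, $q_3\equiv q(a_1,a_2)$ be the quadrances, and $S_1\equiv S(a_1a_2,a_1a_3)$, $S_2\equiv S(a_1a_2,a_2a_3)$, $S_3\equiv S(a_1a_3,a_2a_3)$ the spreads. Then $$\frac{S_1}{q_1}=\frac{S_2}{q_2}=\frac{S_3}{q_3}.$$
   Context: Let $\mathbb F$ be a field of characteristic not two. A 3-proportion $x:y:z$ is a triple of elements of $\mathbb F$, not all zero, up to a common non-zero scalar. A point $a=[x:y:z]$ and a line $L=(l:m:n)$ are both 3-proportions. The point $[x:y:z]$ lies on the line $(l:m:n)$ when $lx+my-nz=0$. For distinct points $a,b$, the join $ab$ is the unique line through both. A point $[x:y:z]$ is null when $x^2+y^2-z^2=0$; a line $(l:m:n)$ is null when $l^2+m^2-n^2=0$. The quadrance between non-null points $a_1=[x_1:y_1:z_1]$, $a_2=[x_2:y_2:z_2]$ is $$q(a_1,a_2)=1-\frac{(x_1x_2+y_1y_2-z_1z_2)^2}{(x_1^2+y_1^2-z_1^2)(x_2^2+y_2^2-z_2^2)}.$$ The spread between non-null lines $L_1=(l_1:m_1:n_1)$, $L_2=(l_2:m_2:n_2)$ is $$S(L_1,L_2)=1-\frac{(l_1l_2+m_1m_2-n_1n_2)^2}{(l_1^2+m_1^2-n_1^2)(l_2^2+m_2^2-n_2^2)}.$$ Quadrances involving null points and spreads involving null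 lines are undefined. *)

theory Defs
  imports Complex_Main
begin

type_synonym 'a triple = "'a \<times> 'a \<times> 'a"

definition proportional :: "'a::field triple \<Rightarrow> 'a triple \<Rightarrow> bool" where
  "proportional = (\<lambda>(x, y, z) (x', y', z').
     (x, y, z) \<noteq> (0, 0, 0) \<and> (x', y', z') \<noteq> (0, 0, 0) \<and>
     (\<exists>c. c \<noteq> 0 \<and> x' = c * x \<and> y' = c * y \<and> z' = c * z))"

lemma part_equivp_proportional: "part_equivp (proportional :: 'a::field triple \<Rightarrow> _)"
proof (rule part_equivpI)
  have "proportional (1, 1, 1) (1, 1, 1 :: 'a)"
    by (auto simp: proportional_def intro: exI[of _ 1])
  then show "\<exists>t::'a triple. proportional t t" by blast
  show "symp (proportional :: 'a triple \<Rightarrow> _)"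
  proof (rule sympI)
    fix s t :: "'a triple"
    assume "proportional s t"
    then show "proportional t s"
      by (fastforce simp: proportional_def intro: exI[of _ "inverse c" for c])
  qed
  show "transp (proportional :: 'a triple \<Rightarrow> _)"
  proof (rule transpI)
    fix s t u :: "'a triple"
    assume st: "proportional s t" and tu: "proportional t u"
    obtain c where "c \<noteq> 0" "t = (c * fst s, c * fst (snd s), c * snd (snd s))"
      using st by (auto simp: proportional_def split: prod.splits)
    moreover obtain d where "d \<noteq> 0" "u = (d * fst t, d * fst (snd t), d * snd (snd t))"
      using tu by (auto simp: proportional_def split: prod.splits)
    ultimately show "proportional s u"
      using st tu by (auto simp: proportional_def split: prod.splits intro!: exI[of _ "d * c"])
  qed
qed

quotient_type (overloaded) 'a proportion = "'a::field triple" / partial: proportional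
  by (rule part_equivp_proportional)

text \<open>Points and lines are both 3-proportions; they are told apart only by their role.\<close>

type_synonym 'a hpoint = "'a proportion"
type_synonym 'a hline = "'a proportion"

text \<open>The same form serves points, lines and incidence, because the incidence condition
  \<open>l x + m y - n z = 0\<close> carries the minus sign too.\<close>

definition form :: "'a::field triple \<Rightarrow> 'a triple \<Rightarrow> 'a" where
  "form = (\<lambda>(x, y, z) (x', y', z'). x * x' + y * y' - z * z')"

lemma form_scale:
  assumes "proportional s s'" and "proportional t t'"
  obtains c d where "c \<noteq> 0" "d \<noteq> 0" "form s' t' = c * d * form s t"
    "form s' s' = c\<^sup>2 * form s s" "form t' t' = d\<^sup>2 * form t t"
proof -
  obtain c d where "c \<noteq> 0" "s' = (c * fst s, c * fst (snd s), c * snd (snd s))"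
      "d \<noteq> 0" "t' = (d * fst t, d * fst (snd t), d * snd (snd t))"
    using assms by (auto simp: proportional_def split: prod.splits)
  then show ?thesis
    by (intro that[of c d]) (auto simp: form_def power2_eq_square algebra_simps split: prod.splits)
qed

lemma normalized_form_cong:
  assumes "proportional s s'" and "proportional t t'"
  shows "(form s t)\<^sup>2 / (form s s * form t t) = (form s' t')\<^sup>2 / (form s' s' * form t' t')"
  by (rule form_scale[OF assms]) (simp add: power_mult_distrib)

lift_definition lies_on :: "'a::field hpoint \<Rightarrow> 'a hline \<Rightarrow> bool"
  is "\<lambda>a L. form L a = 0"
  by (metis form_scale mult_eq_0_iff)

lift_definition null_point :: "'a::field hpoint \<Rightarrow> bool" is "\<lambda>a. form a a = 0"
  by (metis form_scale mult_eq_0_iff)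

lift_definition null_line :: "'a::field hline \<Rightarrow> bool" is "\<lambda>L. form L L = 0"
  by (metis form_scale mult_eq_0_iff)

text \<open>Meaningful only for distinct points; \<open>join_ex1\<close> below justifies the description.\<close>

definition join :: "'a::field hpoint \<Rightarrow> 'a hpoint \<Rightarrow> 'a hline" where
  "join a b = (THE L. lies_on a L \<and> lies_on b L)"

text \<open>Quadrance and spread are meaningful only for non-null arguments; at null arguments
  they take the value 1, by the convention for division by zero.\<close>

lift_definition quadrance :: "'a::field hpoint \<Rightarrow> 'a hpoint \<Rightarrow> 'a"
  is "\<lambda>a b. 1 - (form a b)\<^sup>2 / (form a a * form b b)"
  by (simp add: normalized_form_cong)

lift_definition spread :: "'a::field hline \<Rightarrow> 'a hline \<Rightarrow> 'a"
  is "\<lambda>L M. 1 - (form L M)\<^sup>2 / (form L L * form M M)"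
  by (simp add: normalized_form_cong)

definition cross :: "'a::field triple \<Rightarrow> 'a triple \<Rightarrow> 'a triple" where
  "cross = (\<lambda>(x, y, z) (x', y', z'). (y * z' - z * y', z * x' - x * z', y * x' - x * y'))"

lemma cross_eq_0_imp_proportional:
  assumes "s \<noteq> (0, 0, 0)" "t \<noteq> (0, 0, 0)" "cross s t = (0, 0, 0)"
  shows "proportional s t"
proof -
  obtain x y z where s: "s = (x, y, z)" by (cases s)
  obtain x' y' z' where t: "t = (x', y', z')" by (cases t)
  have e: "y * z' = z * y'" "z * x' = x * z'" "y * x' = x * y'"
    using assms by (auto simp: s t cross_def)
  have "\<exists>c. x' = c * x \<and> y' = c * y \<and> z' = c * z"
  proof -
    consider "x \<noteq> 0" | "y \<noteq> 0" | "z \<noteq> 0" using assms by (auto simp: s)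
    then show ?thesis
    proof cases
      case 1 then show ?thesis using e by (intro exI[of _ "x' / x"]) (simp add: field_simps)
    next
      case 2 then show ?thesis using e by (intro exI[of _ "y' / y"]) (simp add: field_simps)
    next
      case 3 then show ?thesis using e by (intro exI[of _ "z' / z"]) (simp add: field_simps)
    qed
  qed
  then show ?thesis using assms by (auto simp: s t proportional_def)
qed

lemma form_cross: "form (cross s t) s = 0" "form (cross s t) t = 0"
  by (cases s, cases t, simp add: form_def cross_def algebra_simps)+

lemma cross_orthogonal:
  assumes "form l s = 0" "form l t = 0"
  shows "cross l (cross s t) = (0, 0, 0)"
proof -
  obtain x y z where s: "s = (x, y, z)" by (cases s)
  obtain x' y' z' where t: "t = (x', y', z')" by (cases t)
  obtain p q r where l: "l = (p, q, r)" by (cases l)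
  have e: "p * x + q * y - r * z = 0" "p * x' + q * y' - r * z' = 0"
    using assms by (auto simp: s t l form_def)
  have "q * (y * x' - x * y') - r * (z * x' - x * z') = 0"
    "r * (y * z' - z * y') - p * (y * x' - x * y') = 0"
    "q * (y * z' - z * y') - p * (z * x' - x * z') = 0"
    using e by algebra+
  then show ?thesis by (simp add: s t l cross_def)
qed

lemma proportional_nonzero:
  assumes "proportional s t"
  shows "s \<noteq> (0, 0, 0)" "t \<noteq> (0, 0, 0)"
  using assms by (auto simp: proportional_def)

lemma cross_nonzero:
  assumes "proportional s s" "proportional t t" "\<not> proportional s t"
  shows "cross s t \<noteq> (0, 0, 0)"
  using assms cross_eq_0_imp_proportional proportional_nonzero by blast

lemma proportional_refl: "s \<noteq> (0, 0, 0) \<Longrightarrow> proportional s s"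
  by (auto simp: proportional_def intro: exI[of _ 1])

lemma proportional_cross:
  assumes "proportional s s" "proportional t t" "\<not> proportional s t"
    and "proportional l l" "form l s = 0" "form l t = 0"
  shows "proportional l (cross s t)"
  by (rule cross_eq_0_imp_proportional[OF proportional_nonzero(1)[OF assms(4)]
        cross_nonzero[OF assms(1-3)] cross_orthogonal[OF assms(5,6)]])

lemma join_exists:
  assumes "a \<noteq> b"
  shows "\<exists>L. lies_on a L \<and> lies_on b L"
  using assms
proof transfer
  fix s t :: "'a triple"
  assume "proportional s s" "proportional t t" "\<not> proportional s t"
  then have "cross s t \<noteq> (0, 0, 0)" by (rule cross_nonzero)
  then have "proportional (cross s t) (cross s t)" by (rule proportional_refl)
  then show "\<exists>l\<in>{l. proportional l l}. form l s = 0 \<and> form l t = 0"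
    using form_cross by blast
qed

lemma join_unique:
  assumes "a \<noteq> b" "lies_on a L" "lies_on b L" "lies_on a M" "lies_on b M"
  shows "L = M"
  using assms
proof transfer
  fix s t l m :: "'a triple"
  assume p: "proportional s s" "proportional t t" "\<not> proportional s t"
    and l: "proportional l l" "form l s = 0" "form l t = 0"
    and m: "proportional m m" "form m s = 0" "form m t = 0"
  show "proportional l m"
    by (rule part_equivp_transp[OF part_equivp_proportional proportional_cross[OF p l]
          part_equivp_symp[OF part_equivp_proportional proportional_cross[OF p m]]])
qed

lemma join_ex1: "a \<noteq> b \<Longrightarrow> \<exists>!L. lies_on a L \<and> lies_on b L"
  using join_exists join_unique by metis

text \<open>Quadrances of distinct points with a non-null join are non-zero, so that one can
  divide by them.\<close>

lemma form_cross_cross: "form (cross s t) (cross s t) = (form s t)\<^sup>2 - form s s * form t t"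
  by (cases s, cases t, simp add: form_def cross_def power2_eq_square algebra_simps)

lemma quadrance_eq_0_imp_null:
  assumes "a \<noteq> b" "\<not> null_point a" "\<not> null_point b" "lies_on a L" "lies_on b L"
    "quadrance a b = 0"
  shows "null_line L"
  using assms
proof transfer
  fix s t l :: "'a triple"
  assume p: "proportional s s" "proportional t t" "\<not> proportional s t"
    and n: "form s s \<noteq> 0" "form t t \<noteq> 0"
    and l: "proportional l l" "form l s = 0" "form l t = 0"
    and q: "1 - (form s t)\<^sup>2 / (form s s * form t t) = 0"
  have c: "proportional (cross s t) l"
    by (rule part_equivp_symp[OF part_equivp_proportional proportional_cross[OF p l]])
  have z: "form (cross s t) (cross s t) = 0"
    using q n by (simp add: form_cross_cross)
  show "form l l = 0"
    by (rule form_scale[OF c c]) (simp add: z)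
qed

lemma quadrance_nonzero:
  assumes "a \<noteq> b" "\<not> null_point a" "\<not> null_point b" "\<not> null_line (join a b)"
  shows "quadrance a b \<noteq> 0"
proof -
  have "lies_on a (join a b)" "lies_on b (join a b)"
    using theI'[OF join_ex1[OF assms(1)]] by (simp_all add: join_def)
  then show ?thesis using assms quadrance_eq_0_imp_null by blast
qed

end

theory Submission
  imports Defs
begin

text \<open>
  Represent the three points by vectors \<open>s\<close>, \<open>t\<close>, \<open>u\<close> with determinant \<open>D\<close>, and their joins by
  cross products. The cross product of the joins \<open>cross s t\<close> and \<open>cross s u\<close> is \<open>\<plusminus>D s\<close>, so the spread at
  \<open>s\<close> is \<open>-D\<^sup>2 form s s\<close> divided by the norms of these joins, while the quadrance of \<open>s\<close> and \<open>t\<close> is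
  minus the norm of \<open>cross s t\<close> divided by \<open>form s s * form t t\<close>. Hence every ratio of a spread to
  the opposite quadrance equals \<open>D\<^sup>2\<close> times the product of the norms of the three points, divided by
  the product of the norms of the three lines.
\<close>

lemma form_commute: "form s t = form t s"
  by (cases s, cases t) (simp add: form_def algebra_simps)

text \<open>By \<open>form_cross_cross\<close> the left side is the norm of
  \<open>cross (cross s t) (cross s u)\<close>, a vector equal to \<open>s\<close> times minus the
  determinant.\<close>

lemma form_cross_cross_triple:
  "(form (cross s t) (cross s u))\<^sup>2 - form (cross s t) (cross s t) * form (cross s u) (cross s u)
    = (form (cross s t) u)\<^sup>2 * form s s"
proof -
  obtain x y z where s: "s = (x, y, z)" by (cases s)
  define D where "D = form (cross s t) u"
  have "cross (cross s t) (cross s u) = (- (D * x), - (D * y), - (D * z))"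
    unfolding D_def by (cases t, cases u) (simp add: s form_def cross_def algebra_simps)
  moreover have "form (- (D * x), - (D * y), - (D * z)) (- (D * x), - (D * y), - (D * z)) = D\<^sup>2 * form s s"
    by (simp add: s form_def power2_eq_square algebra_simps)
  ultimately have "form (cross (cross s t) (cross s u)) (cross (cross s t) (cross s u))
      = (form (cross s t) u)\<^sup>2 * form s s"
    by (simp add: D_def)
  then show ?thesis by (simp add: form_cross_cross)
qed

lemma form_cross_swap: "form (cross t s) u = - form (cross s t) u"
  by (cases s, cases t, cases u) (simp add: form_def cross_def algebra_simps)

text \<open>Any representative of a join is proportional to a cross product, and the normalized form
  ignores scaling.\<close>

lemma spread_of_cross:
  assumes pts: "proportional s s" "proportional t t" "proportional u u"
    "\<not> proportional s t" "\<not> proportional s u"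
    and l: "proportional l l" "form l s = 0" "form l t = 0" "form l l \<noteq> 0"
    and m: "proportional m m" "form m s = 0" "form m u = 0" "form m m \<noteq> 0"
  shows "form (cross s t) (cross s t) \<noteq> 0" "form (cross s u) (cross s u) \<noteq> 0"
    and "1 - (form l m)\<^sup>2 / (form l l * form m m) =
      - ((form (cross s t) u)\<^sup>2 * form s s) /
        (form (cross s t) (cross s t) * form (cross s u) (cross s u))"
proof -
  have pl: "proportional l (cross s t)"
    using proportional_cross[OF pts(1,2,4) l(1-3)] .
  have pm: "proportional m (cross s u)"
    using proportional_cross[OF pts(1,3,5) m(1-3)] .
  show nz: "form (cross s t) (cross s t) \<noteq> 0" "form (cross s u) (cross s u) \<noteq> 0"
    by (rule form_scale[OF pl pm], use l(4) m(4) in simp)+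
  show "1 - (form l m)\<^sup>2 / (form l l * form m m) =
      - ((form (cross s t) u)\<^sup>2 * form s s) /
        (form (cross s t) (cross s t) * form (cross s u) (cross s u))"
    \<comment> \<open>Read backwards, the triple identity makes the right side split into 1 minus
      the normalized form.\<close>
    unfolding normalized_form_cong[OF pl pm] form_cross_cross_triple[symmetric]
    using nz by (simp add: diff_divide_distrib)
qed

lemma quadrance_of_cross:
  assumes "form s s \<noteq> 0" "form t t \<noteq> 0"
  shows "1 - (form s t)\<^sup>2 / (form s s * form t t)
    = - form (cross s t) (cross s t) / (form s s * form t t)"
  using assms by (simp add: form_cross_cross diff_divide_distrib)

text \<open>Both products reduce to
  \<open>D\<^sup>2 / (form (cross s t) (cross s t) * form u u)\<close>. The lines are given by
  incidence, since \<open>join\<close> is a \<open>THE\<close> description and not a lifted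
  constant.\<close>

lemma spread_mult_quadrance:
  assumes "a \<noteq> b" "a \<noteq> c" "b \<noteq> c"
    and "\<not> null_point a" "\<not> null_point b" "\<not> null_point c"
    and "\<not> null_line L" "\<not> null_line M" "\<not> null_line N"
    and "lies_on a L" "lies_on b L" "lies_on a M" "lies_on c M" "lies_on b N" "lies_on c N"
  shows "spread L M * quadrance a c = spread L N * quadrance b c"
  using assms
proof transfer
  fix s t u l m n :: "'a triple"
  assume p: "proportional s s" "proportional t t" "proportional u u"
    and d: "\<not> proportional s t" "\<not> proportional s u" "\<not> proportional t u"
    and nz: "form s s \<noteq> 0" "form t t \<noteq> 0" "form u u \<noteq> 0"
      "form l l \<noteq> 0" "form m m \<noteq> 0" "form n n \<noteq> 0"
    and lmn: "proportional l l" "proportional m m" "proportional n n"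
    and on: "form l s = 0" "form l t = 0" "form m s = 0" "form m u = 0" "form n t = 0" "form n u = 0"
  have d': "\<not> proportional t s"
    using d(1) part_equivp_symp[OF part_equivp_proportional] by blast
  \<comment> \<open>The spread at \<open>t\<close> comes with \<open>cross t s\<close>; its norm and
    the squared determinant are blind to the change of sign.\<close>
  have swap: "form (cross t s) (cross t s) = form (cross s t) (cross s t)"
    by (simp add: form_cross_cross form_commute mult.commute)
  have det: "(form (cross t s) u)\<^sup>2 = (form (cross s t) u)\<^sup>2"
    by (simp add: form_cross_swap[of t s])
  note S = spread_of_cross[OF p d(1,2) lmn(1) on(1,2) nz(4) lmn(2) on(3,4) nz(5)]
  note S' = spread_of_cross[OF p(2,1,3) d' d(3) lmn(1) on(2,1) nz(4) lmn(3) on(5,6) nz(6)]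
  show "(1 - (form l m)\<^sup>2 / (form l l * form m m)) * (1 - (form s u)\<^sup>2 / (form s s * form u u)) =
      (1 - (form l n)\<^sup>2 / (form l l * form n n)) * (1 - (form t u)\<^sup>2 / (form t t * form u u))"
    unfolding S(3) S'(3) quadrance_of_cross[OF nz(1,3)] quadrance_of_cross[OF nz(2,3)]
      swap det
    using S(1,2) S'(2) nz by (simp add: divide_simps)
qed

lemma quadrance_commute: "quadrance a b = quadrance b a"
  by transfer (simp add: form_commute mult.commute)

lemma spread_commute: "spread L M = spread M L"
  by transfer (simp add: form_commute mult.commute)

lemma lies_on_join:
  assumes "a \<noteq> b"
  shows "lies_on a (join a b)" "lies_on b (join a b)"
  using theI'[OF join_ex1[OF assms]] by (simp_all add: join_def)

theorem theorem45:
  fixes a1 a2 a3 :: "'a::field hpoint"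
    and q1 q2 q3 S1 S2 S3 :: 'a
  assumes "CHAR('a) \<noteq> 2"
    and "a1 \<noteq> a2" "a2 \<noteq> a3" "a1 \<noteq> a3"
    and "\<not> null_point a1" "\<not> null_point a2" "\<not> null_point a3"
    and "\<not> null_line (join a1 a2)" "\<not> null_line (join a2 a3)" "\<not> null_line (join a1 a3)"
    and "q1 = quadrance a2 a3" "q2 = quadrance a1 a3" "q3 = quadrance a1 a2"
    and "S1 = spread (join a1 a2) (join a1 a3)"
    and "S2 = spread (join a1 a2) (join a2 a3)"
    and "S3 = spread (join a1 a3) (join a2 a3)"
  shows "S1 / q1 = S2 / q2 \<and> S2 / q2 = S3 / q3"
proof -
  note on = lies_on_join[OF assms(2)] lies_on_join[OF assms(3)] lies_on_join[OF assms(4)]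
  have q: "q1 \<noteq> 0" "q2 \<noteq> 0" "q3 \<noteq> 0"
    unfolding assms(11-13)
    using quadrance_nonzero[OF assms(3,6,7,9)] quadrance_nonzero[OF assms(4,5,7,10)]
      quadrance_nonzero[OF assms(2,5,6,8)] by simp_all
  have "S1 * q2 = S2 * q1"
    unfolding assms(11,12,14,15)
    using spread_mult_quadrance[OF assms(2,4,3,5,6,7,8,10,9) on(1,2,5,6,3,4)] .
  \<comment> \<open>The same law for the cyclic order \<open>a2\<close>, \<open>a3\<close>,
    \<open>a1\<close>; symmetry of quadrance and spread then restores the order of
    arguments.\<close>
  moreover have "S2 * q3 = S3 * q2"
    unfolding assms(12,13,15,16)
    using spread_mult_quadrance[OF assms(3) assms(2,4)[symmetric] assms(6,7,5,9,8,10)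
        on(3,4,2,1,6,5)]
    by (simp only: quadrance_commute[of _ a1] spread_commute[of "join a2 a3"])
  ultimately show ?thesis using q by (simp add: frac_eq_eq)
qed

end
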